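(* Let $m\ge1$ be an integer and let $C=a\,C_a\oplus b\,C_b$ be an $H_{32}$-code of length $n=2m$, with binary component $C_a\subseteq\mathbb{F}_2^{n}$ and ternary component $C_b\subseteq\mathbb{F}_3^{n}$. Then $C$ is symplectic LCD if and only if $C_a=\{\mathbf{0}\}$ and $C_b$ is ternary symplectic LCD.
   Context: Ring: $H_{32}=\langle a,b\mid 2a=0,\ 3b=0,\ a^2=0,\ b^2=b,\ ab=ba=0\rangle$ is the commutative non-unital ring of order six with elements $0,a,b,a+b,2b,a+2b$. For $\mathbf{x}\in\mathbb{F}_2^n$, $a\mathbf{x}$ is the vector obtained coordinatewise from $a\cdot0=0$, $a\cdot1=a$; for $\mathbf{y}\in\mathbb{F}_3^n$, $b\mathbf{y}$ is obtained coordinatewise from $b\cdot0=0$, $b\cdot1=b$, $b\cdot2=2b$. Every vector of $H_{32}^n$ is uniquely $a\mathbf{x}+b\mathbf{y}$ with $\mathbf{x}\in\mathbb{F}_2^n$, $\mathbf{y}\in\mathbb{F}_3^n$. Codes: an $H_{32}$-code of length $n$ is an $H_{32}$-submodule $C\subseteq H_{32}^n$ (an additive subgroup closed under multiplication by elements of $H_{32}$). It decomposes as $C=aC_a\oplus bC_b=\{a\mathbf{u}+b\mathbf{v}: \mathbf{u}\in C_a,\mathbf{v}\in C_b\}$ with $C_a=\{\mathbf{u}\in\mathbb{F}_2^n: a\mathbf{u}\in C\}$ and $C_b=\{\mathbf{v}\in\mathbb{F}_3^n: b\mathbf{v}\in C\}$, which are linear codes over $\mathbb{F}_2$ and $\mathbb{F}_3$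 respectively. Symplectic forms: for $\mathbf{x}=(\mathbf{x}_1\mid\mathbf{x}_2),\mathbf{y}=(\mathbf{y}_1\mid\mathbf{y}_2)\in\mathbb{F}_3^{2m}$ with $\mathbf{x}_i,\mathbf{y}_i\in\mathbb{F}_3^m$, set $\langle\mathbf{x},\mathbf{y}\rangle_s^{(\mathbb{F}_3)}=\mathbf{x}_1\cdot\mathbf{y}_2-\mathbf{x}_2\cdot\mathbf{y}_1$, where $\cdot$ is the usual dot product. For $\mathbf{c}=a\mathbf{x}+b\mathbf{y}$, $\mathbf{c}'=a\mathbf{x}'+b\mathbf{y}'$ in $H_{32}^{2m}$ (with $\mathbf{x},\mathbf{x}'\in\mathbb{F}_2^{2m}$, $\mathbf{y},\mathbf{y}'\in\mathbb{F}_3^{2m}$), set $\langle\mathbf{c},\mathbf{c}'\rangle_S=b\langle\mathbf{y},\mathbf{y}'\rangle_s^{(\mathbb{F}_3)}$ (the binary part contributes $0$ because $a^2=0$). The symplectic dual $C^{\perp_S}$ of a code $C$ (over $\mathbb{F}_3$ or $H_{32}$, of length $2m$) is the set of all vectors of the ambient space orthogonal to every element of $C$ under the corresponding symplectic form. $C$ is symplectic LCD (linear complementary dual) if $C\cap C^{\perp_S}=\{\mathbf{0}\}$. *)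

theory Defs
  imports
    "Berlekamp_Zassenhaus.Finite_Field"
    "Jordan_Normal_Form.Matrix"
    "HOL-Library.Numeral_Type"
begin

section \<open>The prime fields with two and three elements\<close>

text \<open>The numeral types \<open>2\<close> and \<open>3\<close> are \<open>num1 bit0\<close> and \<open>num1 bit1\<close>; the two instances below are
  what makes \<open>2 mod_ring\<close> and \<open>3 mod_ring\<close> fields.\<close>

instance bit0 :: (CARD_1) prime_card
  by standard (simp add: CARD_1)

instance bit1 :: (CARD_1) prime_card
  by standard (simp add: CARD_1)

type_synonym F2 = "2 mod_ring"
type_synonym F3 = "3 mod_ring"

lemma F2_cases: "(x :: F2) = 0 \<or> x = 1"
proof -
  obtain i where i: "i < CARD(2)" "x = of_nat i" using surj_of_nat_mod_ring[of x] by blast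
  then have "i = 0 \<or> i = 1" by auto
  with i show ?thesis by auto
qed

lemma F3_cases: "(x :: F3) = 0 \<or> x = 1 \<or> x = 2"
proof -
  obtain i where i: "i < CARD(3)" "x = of_nat i" using surj_of_nat_mod_ring[of x] by blast
  then have "i = 0 \<or> i = 1 \<or> i = 2" by auto
  with i show ?thesis by auto
qed

lemma F2_two [simp]: "(2 :: F2) = 0"
  using of_nat_card_eq_0[where ?'a = 2] by simp

lemma F3_three [simp]: "(3 :: F3) = 0"
  using of_nat_card_eq_0[where ?'a = 3] by simp

lemma F3_two_neq [simp]: "(2 :: F3) \<noteq> 0" "(0 :: F3) \<noteq> 2" "(2 :: F3) \<noteq> 1" "(1 :: F3) \<noteq> 2"
proof -
  show "(2 :: F3) \<noteq> 1"
  proof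
    assume "(2 :: F3) = 1"
    then have "(1 :: F3) + 1 = 1 + 0" by simp
    then show False unfolding add_left_cancel by simp
  qed
  then show "(1 :: F3) \<noteq> 2" by metis
  show "(2 :: F3) \<noteq> 0"
  proof
    assume *: "(2 :: F3) = 0"
    have "(3 :: F3) = 2 + 1" by simp
    with * show False by simp
  qed
  then show "(0 :: F3) \<noteq> 2" by metis
qed

section \<open>The ring \<open>H\<^sub>3\<^sub>2\<close>\<close>

text \<open>\<open>H32 x y\<close> is the element \<open>ax + by\<close>.  The product rule is forced by \<open>a\<^sup>2 = ab = ba = 0\<close> and
  \<open>b\<^sup>2 = b\<close>.  That this is the ring given by the presentation is shown in \<open>h32_presentation\<close>.\<close>

datatype h32 = H32 (bin: F2) (ter: F3)

instantiation h32 :: comm_ring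
begin

definition zero_h32 :: h32 where "0 = H32 0 0"
definition plus_h32 :: "h32 \<Rightarrow> h32 \<Rightarrow> h32" where "r + s = H32 (bin r + bin s) (ter r + ter s)"
definition uminus_h32 :: "h32 \<Rightarrow> h32" where "- r = H32 (- bin r) (- ter r)"
definition minus_h32 :: "h32 \<Rightarrow> h32 \<Rightarrow> h32" where "r - s = H32 (bin r - bin s) (ter r - ter s)"
definition times_h32 :: "h32 \<Rightarrow> h32 \<Rightarrow> h32" where "r * s = H32 0 (ter r * ter s)"

instance
  by standard
    (simp_all add: zero_h32_def plus_h32_def uminus_h32_def minus_h32_def times_h32_def algebra_simps)

end

lemmas h32_defs = zero_h32_def plus_h32_def uminus_h32_def minus_h32_def times_h32_def

definition gen_a :: h32 where "gen_a = H32 1 0"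
definition gen_b :: h32 where "gen_b = H32 0 1"

lemma h32_relations:
  "gen_a + gen_a = 0" "gen_b + gen_b + gen_b = 0"
  "gen_a * gen_a = 0" "gen_b * gen_b = gen_b" "gen_a * gen_b = 0" "gen_b * gen_a = 0"
  by (simp_all add: gen_a_def gen_b_def h32_defs)

lemma h32_UNIV:
  "(UNIV :: h32 set) = {0, gen_a, gen_b, gen_a + gen_b, gen_b + gen_b, gen_a + (gen_b + gen_b)}"
proof -
  have "r \<in> {0, gen_a, gen_b, gen_a + gen_b, gen_b + gen_b, gen_a + (gen_b + gen_b)}" for r
    using F2_cases[of "bin r"] F3_cases[of "ter r"]
    by (cases r) (auto simp: gen_a_def gen_b_def h32_defs)
  then show ?thesis by auto
qed

lemma card_h32: "CARD(h32) = 6"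
  unfolding h32_UNIV by (simp add: card_insert_if gen_a_def gen_b_def h32_defs)

text \<open>The products \<open>ax\<close> and \<open>by\<close> of a generator with a scalar of the respective prime field.\<close>

definition a_mult :: "F2 \<Rightarrow> h32" where
  "a_mult x = (if x = 0 then 0 else gen_a)"

definition b_mult :: "F3 \<Rightarrow> h32" where
  "b_mult y = (if y = 0 then 0 else if y = 1 then gen_b else gen_b + gen_b)"

lemma a_mult_eq: "a_mult x = H32 x 0"
  using F2_cases[of x] by (auto simp: a_mult_def gen_a_def h32_defs)

lemma b_mult_eq: "b_mult y = H32 0 y"
  using F3_cases[of y] by (auto simp: b_mult_def gen_b_def h32_defs)

lemma h32_decomp: "r = a_mult (bin r) + b_mult (ter r)"
  by (cases r) (simp add: a_mult_eq b_mult_eq h32_defs)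

lemma h32_presentation:
  fixes p q :: "'r :: ring"
  assumes "p + p = 0" "q + q + q = 0" "p * p = 0" "q * q = q" "p * q = 0" "q * p = 0"
  shows "\<exists>!f :: h32 \<Rightarrow> 'r. (\<forall>r s. f (r + s) = f r + f s) \<and> (\<forall>r s. f (r * s) = f r * f s)
           \<and> f gen_a = p \<and> f gen_b = q"
proof (rule ex_ex1I)
  define f :: "h32 \<Rightarrow> 'r" where
    "f r = (if bin r = 0 then 0 else p) + (if ter r = 0 then 0 else if ter r = 1 then q else q + q)"
    for r
  have four: "(4 :: F3) = 1"
  proof -
    have "(4 :: F3) = 3 + 1" by (simp del: F3_three)
    then show ?thesis by simp
  qed
  have q3: "q + (q + q) = 0" using assms(2) by (simp add: add.assoc)
  then have q4: "q + (q + (q + q)) = q" by simp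
  have p2: "p + (p + t) = t" for t using assms(1) by (simp flip: add.assoc)
  have qp: "q + (p + t) = p + (q + t)" "q + p = p + q" for t by (simp_all add: ac_simps)
  have "f (r + s) = f r + f s" "f (r * s) = f r * f s" for r s
    using F2_cases[of "bin r"] F3_cases[of "ter r"] F2_cases[of "bin s"] F3_cases[of "ter s"]
    by (elim disjE; simp add: f_def plus_h32_def times_h32_def assms four q3 q4 p2 qp add.assoc
      distrib_left distrib_right)+
  moreover have "f gen_a = p" "f gen_b = q" by (simp_all add: f_def gen_a_def gen_b_def)
  ultimately show "\<exists>f :: h32 \<Rightarrow> 'r. (\<forall>r s. f (r + s) = f r + f s) \<and> (\<forall>r s. f (r * s) = f r * f s)
           \<and> f gen_a = p \<and> f gen_b = q" by blast
next
  fix f g :: "h32 \<Rightarrow> 'r"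
  assume f: "(\<forall>r s. f (r + s) = f r + f s) \<and> (\<forall>r s. f (r * s) = f r * f s) \<and> f gen_a = p \<and> f gen_b = q"
    and g: "(\<forall>r s. g (r + s) = g r + g s) \<and> (\<forall>r s. g (r * s) = g r * g s) \<and> g gen_a = p \<and> g gen_b = q"
  have zero: "f 0 = 0" "g 0 = 0" using f g by (metis add_cancel_right_left)+
  have "f r = g r" for r
  proof -
    consider "r = 0" | "r = gen_a" | "r = gen_b" | "r = gen_a + gen_b" | "r = gen_b + gen_b"
      | "r = gen_a + (gen_b + gen_b)"
      using UNIV_I[of r] unfolding h32_UNIV by blast
    then show ?thesis by cases (simp_all add: f g zero)
  qed
  then show "f = g" by blast
qed

section \<open>Codes over \<open>H\<^sub>3\<^sub>2\<close>\<close>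

definition h32_code :: "nat \<Rightarrow> h32 vec set \<Rightarrow> bool" where
  "h32_code n C \<longleftrightarrow>
     C \<subseteq> carrier_vec n \<and> 0\<^sub>v n \<in> C \<and> (\<forall>c\<in>C. \<forall>d\<in>C. c + d \<in> C) \<and> (\<forall>c\<in>C. - c \<in> C) \<and>
     (\<forall>r. \<forall>c\<in>C. r \<cdot>\<^sub>v c \<in> C)"

definition bin_code :: "nat \<Rightarrow> h32 vec set \<Rightarrow> F2 vec set" where
  "bin_code n C = {u \<in> carrier_vec n. map_vec a_mult u \<in> C}"

definition ter_code :: "nat \<Rightarrow> h32 vec set \<Rightarrow> F3 vec set" where
  "ter_code n C = {v \<in> carrier_vec n. map_vec b_mult v \<in> C}"

lemma h32_vec_decomp:
  assumes "c \<in> carrier_vec n"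
  shows "\<exists>!xy. fst xy \<in> carrier_vec n \<and> snd xy \<in> carrier_vec n \<and>
           c = map_vec a_mult (fst xy) + map_vec b_mult (snd xy)"
proof (rule ex1I[of _ "(map_vec bin c, map_vec ter c)"])
  show "fst (map_vec bin c, map_vec ter c) \<in> carrier_vec n \<and>
        snd (map_vec bin c, map_vec ter c) \<in> carrier_vec n \<and>
        c = map_vec a_mult (fst (map_vec bin c, map_vec ter c))
            + map_vec b_mult (snd (map_vec bin c, map_vec ter c))"
    using assms by (auto intro!: eq_vecI simp: h32_decomp[symmetric])
next
  fix xy :: "F2 vec \<times> F3 vec"
  assume "fst xy \<in> carrier_vec n \<and> snd xy \<in> carrier_vec n \<and>
           c = map_vec a_mult (fst xy) + map_vec b_mult (snd xy)"
  then show "xy = (map_vec bin c, map_vec ter c)"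
    by (cases xy) (auto intro!: eq_vecI simp: a_mult_eq b_mult_eq h32_defs)
qed

lemma h32_code_decomp:
  assumes "h32_code n C"
  shows "C = {map_vec a_mult u + map_vec b_mult v | u v. u \<in> bin_code n C \<and> v \<in> ter_code n C}"
proof (intro equalityI subsetI)
  fix c assume c: "c \<in> C"
  then have cn: "c \<in> carrier_vec n" using assms by (auto simp: h32_code_def)
  have b: "map_vec b_mult (map_vec ter c) = gen_b \<cdot>\<^sub>v c"
    by (auto intro!: eq_vecI simp: b_mult_eq gen_b_def h32_defs)
  have a: "map_vec a_mult (map_vec bin c) = c + - (gen_b \<cdot>\<^sub>v c)"
    by (auto intro!: eq_vecI simp: a_mult_eq gen_b_def h32_defs)
  have "gen_b \<cdot>\<^sub>v c \<in> C" using assms c by (auto simp: h32_code_def)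
  then have "map_vec bin c \<in> bin_code n C" "map_vec ter c \<in> ter_code n C"
    unfolding bin_code_def ter_code_def using a b assms c cn by (auto simp: h32_code_def)
  moreover have "c = map_vec a_mult (map_vec bin c) + map_vec b_mult (map_vec ter c)"
    by (auto intro!: eq_vecI simp: h32_decomp[symmetric])
  ultimately show "c \<in> {map_vec a_mult u + map_vec b_mult v | u v. u \<in> bin_code n C \<and> v \<in> ter_code n C}"
    by blast
next
  fix c assume "c \<in> {map_vec a_mult u + map_vec b_mult v | u v. u \<in> bin_code n C \<and> v \<in> ter_code n C}"
  then show "c \<in> C" using assms by (auto simp: h32_code_def bin_code_def ter_code_def)
qed

section \<open>Symplectic forms, duals and LCD codes\<close>

text \<open>The parameter \<open>m\<close> is half the length: vectors have length \<open>2 * m\<close>.\<close>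

definition ter_symp :: "nat \<Rightarrow> F3 vec \<Rightarrow> F3 vec \<Rightarrow> F3" where
  "ter_symp m x y = vec_first x m \<bullet> vec_last y m - vec_last x m \<bullet> vec_first y m"

definition h32_symp :: "nat \<Rightarrow> h32 vec \<Rightarrow> h32 vec \<Rightarrow> h32" where
  "h32_symp m c d = b_mult (ter_symp m (map_vec ter c) (map_vec ter d))"

lemma h32_symp_decomp:
  assumes "x \<in> carrier_vec (2 * m)" "y \<in> carrier_vec (2 * m)"
    and "x' \<in> carrier_vec (2 * m)" "y' \<in> carrier_vec (2 * m)"
  shows "h32_symp m (map_vec a_mult x + map_vec b_mult y) (map_vec a_mult x' + map_vec b_mult y')
           = b_mult (ter_symp m y y')"
proof -
  have "map_vec ter (map_vec a_mult u + map_vec b_mult v) = v"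
    if "u \<in> carrier_vec (2 * m)" "v \<in> carrier_vec (2 * m)" for u v
    using that by (auto intro!: eq_vecI simp: a_mult_eq b_mult_eq h32_defs)
  then show ?thesis using assms by (simp add: h32_symp_def)
qed

definition ter_symp_dual :: "nat \<Rightarrow> F3 vec set \<Rightarrow> F3 vec set" where
  "ter_symp_dual m C = {x \<in> carrier_vec (2 * m). \<forall>c\<in>C. ter_symp m x c = 0}"

definition h32_symp_dual :: "nat \<Rightarrow> h32 vec set \<Rightarrow> h32 vec set" where
  "h32_symp_dual m C = {x \<in> carrier_vec (2 * m). \<forall>c\<in>C. h32_symp m x c = 0}"

definition ter_symp_LCD :: "nat \<Rightarrow> F3 vec set \<Rightarrow> bool" where
  "ter_symp_LCD m C \<longleftrightarrow> C \<inter> ter_symp_dual m C = {0\<^sub>v (2 * m)}"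

definition h32_symp_LCD :: "nat \<Rightarrow> h32 vec set \<Rightarrow> bool" where
  "h32_symp_LCD m C \<longleftrightarrow> C \<inter> h32_symp_dual m C = {0\<^sub>v (2 * m)}"

end

theory Submission
  imports Defs
begin

text \<open>The form on \<open>H\<^sub>3\<^sub>2\<close> only sees the ternary part, so
  \<open>C \<inter> C\<^sup>\<bottom> = a C\<^sub>a \<oplus> b (C\<^sub>b \<inter> C\<^sub>b\<^sup>\<bottom>)\<close>, and this is zero iff both summands are.\<close>

lemma map_vec_bin_a_mult [simp]: "map_vec bin (map_vec a_mult u) = u"
  and map_vec_ter_a_mult [simp]: "map_vec ter (map_vec a_mult u) = 0\<^sub>v (dim_vec u)"
  and map_vec_bin_b_mult [simp]: "map_vec bin (map_vec b_mult v) = 0\<^sub>v (dim_vec v)"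
  and map_vec_ter_b_mult [simp]: "map_vec ter (map_vec b_mult v) = v"
  by (auto intro!: eq_vecI simp: a_mult_eq b_mult_eq)

lemma map_vec_bin_add:
    "c \<in> carrier_vec n \<Longrightarrow> d \<in> carrier_vec n \<Longrightarrow> map_vec bin (c + d) = map_vec bin c + map_vec bin d"
  and map_vec_ter_add:
    "c \<in> carrier_vec n \<Longrightarrow> d \<in> carrier_vec n \<Longrightarrow> map_vec ter (c + d) = map_vec ter c + map_vec ter d"
  by (auto intro!: eq_vecI simp: plus_h32_def)

lemma h32_vec_eq_0_iff:
  assumes "c \<in> carrier_vec n"
  shows "c = 0\<^sub>v n \<longleftrightarrow> map_vec bin c = 0\<^sub>v n \<and> map_vec ter c = 0\<^sub>v n"
  using assms by (auto simp: vec_eq_iff zero_h32_def h32.expand)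

text \<open>The components \<open>u\<close>, \<open>v\<close> in the decomposition of a code are
  recovered from \<open>c\<close> by the projections \<open>bin\<close> and \<open>ter\<close>, so
  the existential description of \<open>C\<close> becomes a test on each component
  separately.\<close>

lemma mem_h32_code_iff:
  assumes "h32_code n C"
  shows "c \<in> C \<longleftrightarrow>
    c \<in> carrier_vec n \<and> map_vec bin c \<in> bin_code n C \<and> map_vec ter c \<in> ter_code n C"
proof
  assume "c \<in> C"
  moreover from this have "c \<in> carrier_vec n"
    using assms by (auto simp: h32_code_def)
  moreover obtain u v where uv: "c = map_vec a_mult u + map_vec b_mult v"
      "u \<in> bin_code n C" "v \<in> ter_code n C"
    using h32_code_decomp[OF assms] \<open>c \<in> C\<close> by blast
  moreover have "u \<in> carrier_vec n" "v \<in> carrier_vec n"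
    using uv by (auto simp: bin_code_def ter_code_def)
  ultimately show "c \<in> carrier_vec n \<and> map_vec bin c \<in> bin_code n C \<and> map_vec ter c \<in> ter_code n C"
    by (simp add: map_vec_bin_add[where n = n] map_vec_ter_add[where n = n])
next
  assume "c \<in> carrier_vec n \<and> map_vec bin c \<in> bin_code n C \<and> map_vec ter c \<in> ter_code n C"
  moreover have "c = map_vec a_mult (map_vec bin c) + map_vec b_mult (map_vec ter c)"
    by (auto intro!: eq_vecI simp: h32_decomp[symmetric])
  ultimately show "c \<in> C"
    using h32_code_decomp[OF assms] by blast
qed

text \<open>Although \<open>ter_code\<close> is defined as a preimage under \<open>b_mult\<close>,
  it is also a projection: \<open>map_vec b_mult v\<close> is a codeword lying over
  \<open>v\<close>. This lets the quantifier over \<open>C\<close> in the dual range over ternary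
  codewords.\<close>

lemma ter_code_eq_image:
  assumes "h32_code n C"
  shows "ter_code n C = map_vec ter ` C"
proof
  show "ter_code n C \<subseteq> map_vec ter ` C"
  proof
    fix v assume "v \<in> ter_code n C"
    then have "map_vec b_mult v \<in> C" by (simp add: ter_code_def)
    then show "v \<in> map_vec ter ` C" by (rule rev_image_eqI) simp
  qed
  show "map_vec ter ` C \<subseteq> ter_code n C"
    using mem_h32_code_iff[OF assms] by blast
qed

text \<open>The form reads only ternary parts and \<open>b_mult\<close> vanishes only at 0, so
  duality leaves the binary part of \<open>c\<close> unconstrained.\<close>

lemma mem_h32_symp_dual_iff:
  assumes "h32_code (2 * m) C"
  shows "c \<in> h32_symp_dual m C \<longleftrightarrow>
    c \<in> carrier_vec (2 * m) \<and> map_vec ter c \<in> ter_symp_dual m (ter_code (2 * m) C)"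
  by (auto simp: h32_symp_dual_def ter_symp_dual_def ter_code_eq_image[OF assms] h32_symp_def
      b_mult_eq zero_h32_def)

theorem theorem4p14:
  fixes m :: nat and C :: "h32 vec set"
  assumes "m \<ge> 1"
    and "h32_code (2 * m) C"
  shows "h32_symp_LCD m C \<longleftrightarrow>
           bin_code (2 * m) C = {0\<^sub>v (2 * m)} \<and> ter_symp_LCD m (ter_code (2 * m) C)"
proof -
  let ?n = "2 * m"
  let ?B = "bin_code ?n C"
  let ?T = "ter_code ?n C \<inter> ter_symp_dual m (ter_code ?n C)"
  \<comment> \<open>The hull splits as a product whose binary factor is all of \<open>?B\<close>;
    this is why LCD forces the binary component to vanish.\<close>
  have hull: "c \<in> C \<inter> h32_symp_dual m C \<longleftrightarrow>
      c \<in> carrier_vec ?n \<and> map_vec bin c \<in> ?B \<and> map_vec ter c \<in> ?T" for c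
    using mem_h32_code_iff[OF assms(2)] mem_h32_symp_dual_iff[OF assms(2)] by blast
  have carrier: "u \<in> ?B \<Longrightarrow> u \<in> carrier_vec ?n" "v \<in> ?T \<Longrightarrow> v \<in> carrier_vec ?n" for u v
    by (auto simp: bin_code_def ter_code_def)
  have "C \<inter> h32_symp_dual m C = {0\<^sub>v ?n} \<longleftrightarrow> ?B = {0\<^sub>v ?n} \<and> ?T = {0\<^sub>v ?n}"
  proof
    assume lcd: "C \<inter> h32_symp_dual m C = {0\<^sub>v ?n}"
    have map_0: "map_vec bin (0\<^sub>v ?n) = 0\<^sub>v ?n" "map_vec ter (0\<^sub>v ?n) = 0\<^sub>v ?n"
      using h32_vec_eq_0_iff[of "0\<^sub>v ?n" ?n] by simp_all
    with lcd hull[of "0\<^sub>v ?n"] have zero: "0\<^sub>v ?n \<in> ?B" "0\<^sub>v ?n \<in> ?T"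
      by auto
    have "u = 0\<^sub>v ?n" if "u \<in> ?B" for u
    proof -
      \<comment> \<open>The ternary part of this witness is \<open>0\<^sub>v ?n\<close>, which lies
        in \<open>?T\<close>, so every binary codeword yields a hull element.\<close>
      have "map_vec a_mult u \<in> C \<inter> h32_symp_dual m C"
        unfolding hull using that zero carrier(1)[OF that] by simp
      then have "map_vec a_mult u = 0\<^sub>v ?n" using lcd by blast
      then show ?thesis
        using map_0 map_vec_bin_a_mult[of u] by simp
    qed
    moreover have "v = 0\<^sub>v ?n" if "v \<in> ?T" for v
    proof -
      \<comment> \<open>Likewise with zero binary part, which lies in \<open>?B\<close>.\<close>
      have "map_vec b_mult v \<in> C \<inter> h32_symp_dual m C"
        unfolding hull using that zero carrier(2)[OF that] by simp
      then have "map_vec b_mult v = 0\<^sub>v ?n" using lcd by blast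
      then show ?thesis
        using map_0 map_vec_ter_b_mult[of v] by simp
    qed
    ultimately show "?B = {0\<^sub>v ?n} \<and> ?T = {0\<^sub>v ?n}"
      using zero by blast
  next
    assume "?B = {0\<^sub>v ?n} \<and> ?T = {0\<^sub>v ?n}"
    \<comment> \<open>Both factors are trivial, and a vector is determined by its two
      projections.\<close>
    then have "c \<in> C \<inter> h32_symp_dual m C \<longleftrightarrow> c = 0\<^sub>v ?n" for c
      unfolding hull using h32_vec_eq_0_iff[of c ?n] by auto
    then show "C \<inter> h32_symp_dual m C = {0\<^sub>v ?n}" by blast
  qed
  then show ?thesis
    by (simp add: h32_symp_LCD_def ter_symp_LCD_def)
qed

end
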